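(* Let $N\ge0$ be a fixed integer. For $\mu>0$ set $q=e^{-\mu}$, $\lambda=e^{\mu N}-1$, $\beta_q=\sqrt{\frac{1+q}{1-q}}$, $\psi_n(x)=\sqrt{\beta_q}\,h_n(\beta_qx)\,e^{-\beta_q^2x^2/2}$ and $$K_\lambda(x,y)=\sum_{n=0}^\infty\frac{\lambda q^{n+1/2}}{1+\lambda q^{n+1/2}}\psi_n(x)\psi_n(y).$$ Then $$\lim_{\mu\to\infty}K_\lambda(x,y)=\sum_{n=0}^{N-1}h_n(x)h_n(y)e^{-(x^2+y^2)/2}$$ uniformly for $x,y$ in a compact set, and $$\lim_{\mu\to0+}K_\lambda(x,y)=\begin{cases}\frac N{\sqrt\pi}e^{-x^2}&\text{if }x=y,\\0&\text{if }x\ne y,\end{cases}$$ pointwise.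
   Context: $h_n$, $n\ge0$, are the normalized Hermite polynomials, $h_n(x)=\pi^{-1/4}(2^nn!)^{-1/2}H_n(x)$, orthonormal with respect to $e^{-x^2}dx$ on $\mathbb{R}$. *)

theory Defs
  imports "HOL-Analysis.Analysis" "HOL-Computational_Algebra.Polynomial"
begin

text \<open>The physicists' Hermite polynomials (leading coefficient \<open>2 ^ n\<close>, weight \<open>exp (- x\<^sup>2)\<close>),
  given by Rodrigues' formula.\<close>

definition Hermite :: "nat \<Rightarrow> real \<Rightarrow> real" where
  "Hermite n x = (- 1) ^ n * exp (x\<^sup>2) * (deriv ^^ n) (\<lambda>t. exp (- t\<^sup>2)) x"

text \<open>The iterated derivatives above exist in the classical sense: they are \<open>exp (- x\<^sup>2)\<close> times
  polynomials, which up to sign are the \<open>Hermite n\<close>.\<close>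

primrec Hermite_poly :: "nat \<Rightarrow> real poly" where
  "Hermite_poly 0 = 1"
| "Hermite_poly (Suc n) = [:0, 2:] * Hermite_poly n - pderiv (Hermite_poly n)"

lemma deriv_gaussian_iterated:
  "(deriv ^^ n) (\<lambda>t::real. exp (- t\<^sup>2)) = (\<lambda>x. (- 1) ^ n * poly (Hermite_poly n) x * exp (- x\<^sup>2))"
proof (induction n)
  case 0
  then show ?case by simp
next
  case (Suc n)
  have "((\<lambda>x. (- 1) ^ n * poly (Hermite_poly n) x * exp (- x\<^sup>2)) has_real_derivative
      (- 1) ^ Suc n * poly (Hermite_poly (Suc n)) x * exp (- x\<^sup>2)) (at x)" for x :: real
    by (auto intro!: derivative_eq_intros poly_DERIV simp: algebra_simps)
  then show ?case
    by (auto simp: Suc DERIV_imp_deriv)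
qed

lemma Hermite_eq_poly: "Hermite n x = poly (Hermite_poly n) x"
proof -
  have "(- 1 :: real) ^ n * (- 1) ^ n = 1"
    by (simp flip: power_mult_distrib)
  moreover have "exp (x\<^sup>2) * exp (- x\<^sup>2) = 1"
    by (simp flip: exp_add)
  moreover have "Hermite n x = ((- 1) ^ n * (- 1) ^ n) * (exp (x\<^sup>2) * exp (- x\<^sup>2)) * poly (Hermite_poly n) x"
    by (simp add: Hermite_def deriv_gaussian_iterated)
  ultimately show ?thesis by simp
qed

definition hermite_normalized :: "nat \<Rightarrow> real \<Rightarrow> real" where
  "hermite_normalized n x = pi powr (- 1 / 4) * (2 ^ n * fact n) powr (- 1 / 2) * Hermite n x"

definition beta_q :: "real \<Rightarrow> real" where
  "beta_q q = sqrt ((1 + q) / (1 - q))"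

definition psi_q :: "real \<Rightarrow> nat \<Rightarrow> real \<Rightarrow> real" where
  "psi_q q n x = sqrt (beta_q q) * hermite_normalized n (beta_q q * x) * exp (- (beta_q q)\<^sup>2 * x\<^sup>2 / 2)"

text \<open>The kernel is used only for \<open>0 < q < 1\<close> and \<open>lam \<ge> 0\<close>, where the series converges.\<close>

definition hermite_kernel :: "real \<Rightarrow> real \<Rightarrow> real \<Rightarrow> real \<Rightarrow> real" where
  "hermite_kernel q lam x y =
    (\<Sum>n. lam * q powr (real n + 1 / 2) / (1 + lam * q powr (real n + 1 / 2)) * psi_q q n x * psi_q q n y)"

end

theory Submission
  imports Defs "HOL-Complex_Analysis.Complex_Analysis" "HOL-Real_Asymp.Real_Asymp"
begin

text \<open>Everything rests on Mehler's formula. Its closed form, as a function of the summation variable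
  \<open>z\<close>, is holomorphic on the unit disc and solves a first-order linear differential equation. The
  Hermite series solves the same equation formally, since the products \<open>Hermite n x * Hermite n y\<close>
  inherit a five-term recurrence from the three-term recurrence; so both have the same coefficients,
  and the convergence of the series comes for free.

  As \<open>\<mu> \<rightarrow> 0\<close>, replacing \<open>t / (1 + t)\<close> by \<open>t = lam * q powr (n + 1 / 2)\<close> in the kernel costs at most
  \<open>lam\<^sup>2 / (sqrt pi * (1 - q)) \<rightarrow> 0\<close>, and the linearized kernel is summed by Mehler's formula. As
  \<open>\<mu> \<rightarrow> \<infinity>\<close>, the weights with \<open>n < N\<close> tend to 1, while the remaining terms are of size
  \<open>sqrt q * q ^ (n - N) * 2 ^ n\<close>, because Mehler's formula at \<open>1 / 2\<close> bounds
  \<open>(hermite_normalized n x)\<^sup>2 * exp (- x\<^sup>2)\<close> by \<open>2 ^ n\<close>.\<close>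

section \<open>Mehler's formula\<close>

lemma pderiv_Hermite_poly:
  "pderiv (Hermite_poly n) = smult (2 * real n) (Hermite_poly (n - 1))"
proof (induction n)
  case (Suc n)
  have "pderiv (Hermite_poly (Suc n)) =
      smult 2 (Hermite_poly n) + [:0, 2:] * pderiv (Hermite_poly n) - pderiv (pderiv (Hermite_poly n))"
    by (simp add: pderiv_mult pderiv_diff pderiv_pCons pderiv_smult)
  also have "\<dots> = smult 2 (Hermite_poly n)
      + smult (2 * real n) ([:0, 2:] * Hermite_poly (n - 1) - pderiv (Hermite_poly (n - 1)))"
    by (simp only: Suc pderiv_smult smult_diff_right mult_smult_right add_diff_eq)
  \<comment> \<open>For \<open>n = 0\<close> the truncated \<open>n - 1\<close> does no harm, since
    the factor \<open>2 * real n\<close> vanishes; otherwise this is the defining recursion at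
    \<open>n - 1\<close>.\<close>
  also have "smult (2 * real n) ([:0, 2:] * Hermite_poly (n - 1) - pderiv (Hermite_poly (n - 1)))
      = smult (2 * real n) (Hermite_poly n)"
    by (cases n) simp_all
  finally show ?case
    by (simp add: smult_add_left[symmetric] add.commute ring_distribs del: Hermite_poly.simps)
qed simp

lemma Hermite_0: "Hermite 0 x = 1"
  and Hermite_1: "Hermite (Suc 0) x = 2 * x"
  by (simp_all add: Hermite_eq_poly)

lemma Hermite_rec:
  "Hermite (Suc (Suc n)) x = 2 * x * Hermite (Suc n) x - 2 * (real n + 1) * Hermite n x"
proof -
  have "Hermite_poly (Suc (Suc n)) = [:0, 2:] * Hermite_poly (Suc n) - pderiv (Hermite_poly (Suc n))"
    by (rule Hermite_poly.simps)
  also have "pderiv (Hermite_poly (Suc n)) = smult (2 * (real n + 1)) (Hermite_poly n)"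
    by (simp add: pderiv_Hermite_poly add.commute del: Hermite_poly.simps)
  finally have "poly (Hermite_poly (Suc (Suc n))) x =
      poly ([:0, 2:] * Hermite_poly (Suc n) - smult (2 * (real n + 1)) (Hermite_poly n)) x"
    by (rule arg_cong)
  then show ?thesis
    by (simp add: Hermite_eq_poly del: Hermite_poly.simps)
qed

definition mehler_coeff :: "real \<Rightarrow> real \<Rightarrow> nat \<Rightarrow> real" where
  "mehler_coeff x y n = Hermite n x * Hermite n y / (2 ^ n * fact n)"

text \<open>This is the comparison of the coefficients of \<open>z ^ (n + 3)\<close> in the
  differential equation of Mehler's generating function. The three-term recurrence expresses all
  Hermite values through those at \<open>n\<close> and \<open>n + 1\<close>, which leaves a
  polynomial identity.\<close>

lemma mehler_coeff_rec:
  "(real n + 4) * mehler_coeff x y (n + 4) - 2 * (real n + 2) * mehler_coeff x y (n + 2)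
     + real n * mehler_coeff x y n
   = mehler_coeff x y (n + 2) - mehler_coeff x y n
     + 2 * x * y * (mehler_coeff x y (n + 3) + mehler_coeff x y (n + 1))
     - 2 * (x\<^sup>2 + y\<^sup>2) * mehler_coeff x y (n + 2)"
proof -
  have H: "Hermite (n + 2) z = 2 * z * Hermite (n + 1) z - 2 * (real n + 1) * Hermite n z"
    "Hermite (n + 3) z = 2 * z * Hermite (n + 2) z - 2 * (real n + 2) * Hermite (n + 1) z"
    "Hermite (n + 4) z = 2 * z * Hermite (n + 3) z - 2 * (real n + 3) * Hermite (n + 2) z" for z
    using Hermite_rec[of n z] Hermite_rec[of "n + 1" z] Hermite_rec[of "n + 2" z]
    by (simp_all add: numeral_eq_Suc algebra_simps)
  have F: "fact (n + 1) = (real n + 1) * fact n" "fact (n + 2) = (real n + 2) * (real n + 1) * fact n"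
    "fact (n + 3) = (real n + 3) * (real n + 2) * (real n + 1) * fact n"
    "fact (n + 4) = (real n + 4) * (real n + 3) * (real n + 2) * (real n + 1) * fact n"
    by (simp_all add: numeral_eq_Suc algebra_simps)
  define c :: real where "c = 2 ^ n * fact n"
  define k where "k = real n"
  define u0 where "u0 = Hermite n x"
  define u1 where "u1 = Hermite (n + 1) x"
  define v0 where "v0 = Hermite n y"
  define v1 where "v1 = Hermite (n + 1) y"
  have nz: "c \<noteq> 0" "k + 1 \<noteq> 0" "k + 2 \<noteq> 0" "k + 3 \<noteq> 0" "k + 4 \<noteq> 0"
    by (auto simp: c_def k_def)
  define u2 where "u2 = 2 * x * u1 - 2 * (k + 1) * u0"
  define v2 where "v2 = 2 * y * v1 - 2 * (k + 1) * v0"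
  define u3 where "u3 = 2 * x * u2 - 2 * (k + 2) * u1"
  define v3 where "v3 = 2 * y * v2 - 2 * (k + 2) * v1"
  define u4 where "u4 = 2 * x * u3 - 2 * (k + 3) * u2"
  define v4 where "v4 = 2 * y * v3 - 2 * (k + 3) * v2"
  define M where "M = 16 * c * (k + 3) * (k + 2) * (k + 1)"
  \<comment> \<open>\<open>M\<close> clears all denominators except the factor \<open>k + 4\<close>, which the recurrence provides.\<close>
  have M: "M \<noteq> 0" using nz by (simp add: M_def)
  have m: "M * mehler_coeff x y n = 16 * (k + 3) * (k + 2) * (k + 1) * (u0 * v0)"
    "M * mehler_coeff x y (n + 1) = 8 * (k + 3) * (k + 2) * (u1 * v1)"
    "M * mehler_coeff x y (n + 2) = 4 * (k + 3) * (u2 * v2)"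
    "M * mehler_coeff x y (n + 3) = 2 * (u3 * v3)"
    "(k + 4) * (M * mehler_coeff x y (n + 4)) = u4 * v4"
    using nz
    unfolding mehler_coeff_def F H M_def u0_def u1_def u2_def u3_def u4_def v0_def v1_def v2_def v3_def v4_def
    by (simp_all add: c_def[symmetric] k_def[symmetric] power_add divide_simps)
       (simp_all add: c_def k_def)
  \<comment> \<open>After unfolding, this holds identically in \<open>x\<close>, \<open>y\<close>,
    \<open>k\<close> and the starting values \<open>u0\<close>, \<open>u1\<close>,
    \<open>v0\<close>, \<open>v1\<close>; nothing else about Hermite polynomials enters.\<close>
  have "u4 * v4 - 2 * (k + 2) * (4 * (k + 3) * (u2 * v2)) + k * (16 * (k + 3) * (k + 2) * (k + 1) * (u0 * v0))
   = 4 * (k + 3) * (u2 * v2) - 16 * (k + 3) * (k + 2) * (k + 1) * (u0 * v0)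
     + 2 * x * y * (2 * (u3 * v3) + 8 * (k + 3) * (k + 2) * (u1 * v1))
     - 2 * (x\<^sup>2 + y\<^sup>2) * (4 * (k + 3) * (u2 * v2))"
    unfolding u4_def v4_def u3_def v3_def u2_def v2_def by algebra
  then have "M * ((k + 4) * mehler_coeff x y (n + 4) - 2 * (k + 2) * mehler_coeff x y (n + 2)
     + k * mehler_coeff x y n)
   = M * (mehler_coeff x y (n + 2) - mehler_coeff x y n
     + 2 * x * y * (mehler_coeff x y (n + 3) + mehler_coeff x y (n + 1))
     - 2 * (x\<^sup>2 + y\<^sup>2) * mehler_coeff x y (n + 2))"
    unfolding m[symmetric] by (simp add: algebra_simps)
  with M show ?thesis by (simp add: k_def)
qed

section \<open>The differential equation of the formal Mehler series\<close>

lemma fps_linear_ode_unique: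
  fixes F G Q :: "'a :: field_char_0 fps"
  assumes "fps_deriv F = Q * F" "fps_deriv G = Q * G" "fps_nth F 0 = fps_nth G 0"
  shows "F = G"
proof (rule fps_ext)
  fix n show "fps_nth F n = fps_nth G n"
  proof (induction n rule: less_induct)
    case (less n)
    show ?case
    proof (cases n)
      case (Suc m)
      \<comment> \<open>Coefficient \<open>m\<close> of \<open>Q * F\<close> involves
        \<open>F\<close> only up to index \<open>m\<close>, whereas coefficient \<open>m\<close> of
        \<open>fps_deriv F\<close> is \<open>m + 1\<close> times coefficient \<open>m + 1\<close> of
        \<open>F\<close>. Characteristic 0 allows the division.\<close>
      have "fps_nth (Q * F) m = fps_nth (Q * G) m"
        unfolding fps_mult_nth using less Suc by (intro sum.cong) auto
      then have "fps_nth (fps_deriv F) m = fps_nth (fps_deriv G) m"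
        by (simp only: assms)
      then show ?thesis using Suc of_nat_neq_0[of m, where ?'a = 'a] by (simp del: of_nat_Suc)
    qed (use assms in simp)
  qed
qed

text \<open>The coefficients are embedded into the complex numbers so that the series can be
  compared with the expansion of a holomorphic function.\<close>

definition mehler_fps :: "real \<Rightarrow> real \<Rightarrow> complex fps" where
  "mehler_fps x y = Abs_fps (\<lambda>n. of_real (mehler_coeff x y n))"

lemma mehler_fps_ode:
  "(1 - fps_X\<^sup>2)\<^sup>2 * fps_deriv (mehler_fps x y) =
   (fps_X * (1 - fps_X\<^sup>2) + fps_const (of_real (2 * x * y)) * (1 + fps_X\<^sup>2)
     - fps_const (of_real (2 * (x\<^sup>2 + y\<^sup>2))) * fps_X) * mehler_fps x y" (is "?L = ?R")
proof (rule fps_ext)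
  fix n :: nat
  let ?A = "mehler_fps x y" and ?D = "fps_deriv (mehler_fps x y)"
  \<comment> \<open>Expanding into monomial multiples turns the extraction of coefficients into
    index shifts.\<close>
  have L: "?L = ?D - 2 * (fps_X ^ 2 * ?D) + fps_X ^ 4 * ?D" by algebra
  have R: "?R = fps_X ^ 1 * ?A - fps_X ^ 3 * ?A + fps_const (of_real (2 * x * y)) * (?A + fps_X ^ 2 * ?A)
      - fps_const (of_real (2 * (x\<^sup>2 + y\<^sup>2))) * (fps_X ^ 1 * ?A)"
    by (simp add: algebra_simps power2_eq_square power3_eq_cube)
  let ?m = "mehler_coeff x y"
  \<comment> \<open>The recurrence starting at index \<open>k\<close> describes coefficient
    \<open>k + 3\<close>, so the three lowest coefficients are computed by hand.\<close>
  consider "n = 0" | "n = 1" | "n = 2" | k where "n = k + 3"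
  proof -
    have "n = 0 \<or> n = 1 \<or> n = 2 \<or> n = (n - 3) + 3" by arith
    then show ?thesis using that by blast
  qed
  then show "fps_nth ?L n = fps_nth ?R n"
  proof cases
    case 1
    show ?thesis unfolding L R
      by (simp add: 1 fps_X_power_mult_nth mehler_fps_def mehler_coeff_def Hermite_0 Hermite_1 numeral_fps_const)
  next
    case 2
    show ?thesis unfolding L R
      by (simp add: 2 fps_X_power_mult_nth mehler_fps_def mehler_coeff_def numeral_eq_Suc
          Hermite_0 Hermite_1 Hermite_rec numeral_fps_const)
         (simp add: field_simps power2_eq_square)
  next
    case 3
    show ?thesis unfolding L R
      by (simp add: 3 fps_X_power_mult_nth mehler_fps_def mehler_coeff_def numeral_eq_Suc
          Hermite_0 Hermite_1 Hermite_rec numeral_fps_const)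
         (simp add: field_simps power2_eq_square Hermite_0 Hermite_1)
  next
    case 4
    \<comment> \<open>The last summand comes from coefficient \<open>k - 1\<close> of the
      derivative. For \<open>k = 0\<close> there is no such coefficient, which agrees with the
      factor \<open>real k\<close>; hence the case split on \<open>k\<close>.\<close>
    have "fps_nth ?L n = of_real ((real k + 4) * ?m (k + 4) - 2 * (real k + 2) * ?m (k + 2) + real k * ?m k)"
      unfolding L
      by (cases k) (simp_all add: 4 fps_X_power_mult_nth mehler_fps_def numeral_fps_const
          fps_mult_left_const_nth numeral_eq_Suc algebra_simps)
    also have "\<dots> = fps_nth ?R n"
      unfolding R mehler_coeff_rec
      by (simp add: 4 fps_X_power_mult_nth mehler_fps_def numeral_eq_Suc algebra_simps)
    finally show ?thesis .
  qed
qed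

section \<open>The closed form as a holomorphic function on the unit disc\<close>

definition mehler_fun :: "real \<Rightarrow> real \<Rightarrow> complex \<Rightarrow> complex" where
  "mehler_fun x y z = (1 - z\<^sup>2) powr (-1 / 2) *
     exp ((of_real (2 * x * y) * z - of_real (x\<^sup>2 + y\<^sup>2) * z\<^sup>2) / (1 - z\<^sup>2))"

text \<open>Keeps \<open>1 - z\<^sup>2\<close> off the branch cut of the principal power and makes
  it a legitimate denominator.\<close>

lemma one_minus_square_pos:
  fixes z :: complex
  assumes "z \<in> ball 0 1"
  shows "Re (1 - z\<^sup>2) > 0" "1 - z\<^sup>2 \<noteq> 0" "1 - z\<^sup>2 \<notin> \<real>\<^sub>\<le>\<^sub>0"
proof -
  have "norm (z\<^sup>2) < 1"
    using assms by (simp add: norm_power power_less_one_iff)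
  then show "Re (1 - z\<^sup>2) > 0"
    using complex_Re_le_cmod[of "z\<^sup>2"] by simp
  then show "1 - z\<^sup>2 \<noteq> 0" "1 - z\<^sup>2 \<notin> \<real>\<^sub>\<le>\<^sub>0"
    by (auto simp: complex_nonpos_Reals_iff)
qed

text \<open>The rational factor is the logarithmic derivative: \<open>z / (1 - z\<^sup>2)\<close>
  from the power, plus the derivative of the exponent. It is the quotient that occurs in
  \<open>mehler_fps_ode\<close>.\<close>

lemma mehler_fun_deriv:
  assumes "z \<in> ball 0 1"
  shows "(mehler_fun x y has_field_derivative
    (z * (1 - z\<^sup>2) + of_real (2 * x * y) * (1 + z\<^sup>2) - of_real (2 * (x\<^sup>2 + y\<^sup>2)) * z)
      / (1 - z\<^sup>2)\<^sup>2 * mehler_fun x y z) (at z)"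
proof -
  note nz = one_minus_square_pos[OF assms]
  define a where "a = complex_of_real (2 * x * y)"
  define b where "b = complex_of_real (x\<^sup>2 + y\<^sup>2)"
  have "((\<lambda>z. (1 - z\<^sup>2) powr (-1 / 2)) has_field_derivative z / (1 - z\<^sup>2) * (1 - z\<^sup>2) powr (-1 / 2)) (at z)"
  proof -
    \<comment> \<open>Differentiation lowers the exponent by one; this restores the original
      power.\<close>
    have "(1 - z\<^sup>2) powr (-1 / 2 - 1) = (1 - z\<^sup>2) powr (-1 / 2) / (1 - z\<^sup>2)"
      using nz by (simp only: powr_diff powr_to_1 if_False)
    moreover have "2 - 2 * z\<^sup>2 \<noteq> 0"
      using nz(2) by auto
    ultimately show ?thesis
      using nz by (auto intro!: derivative_eq_intros simp: frac_eq_eq algebra_simps)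
  qed
  moreover have "((\<lambda>z. exp ((a * z - b * z\<^sup>2) / (1 - z\<^sup>2))) has_field_derivative
      ((a - 2 * b * z) * (1 - z\<^sup>2) + 2 * z * (a * z - b * z\<^sup>2)) / (1 - z\<^sup>2)\<^sup>2 *
      exp ((a * z - b * z\<^sup>2) / (1 - z\<^sup>2))) (at z)"
    using nz by (auto intro!: derivative_eq_intros simp: power2_eq_square mult_ac)
  ultimately have "(mehler_fun x y has_field_derivative
      z / (1 - z\<^sup>2) * (1 - z\<^sup>2) powr (-1 / 2) * exp ((a * z - b * z\<^sup>2) / (1 - z\<^sup>2)) +
      ((a - 2 * b * z) * (1 - z\<^sup>2) + 2 * z * (a * z - b * z\<^sup>2)) / (1 - z\<^sup>2)\<^sup>2 *
      exp ((a * z - b * z\<^sup>2) / (1 - z\<^sup>2)) * (1 - z\<^sup>2) powr (-1 / 2)) (at z)"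
    unfolding mehler_fun_def[abs_def] a_def b_def by (rule DERIV_mult)
  also have "z / (1 - z\<^sup>2) * (1 - z\<^sup>2) powr (-1 / 2) * exp ((a * z - b * z\<^sup>2) / (1 - z\<^sup>2)) +
      ((a - 2 * b * z) * (1 - z\<^sup>2) + 2 * z * (a * z - b * z\<^sup>2)) / (1 - z\<^sup>2)\<^sup>2 *
      exp ((a * z - b * z\<^sup>2) / (1 - z\<^sup>2)) * (1 - z\<^sup>2) powr (-1 / 2)
    = (z / (1 - z\<^sup>2) + ((a - 2 * b * z) * (1 - z\<^sup>2) + 2 * z * (a * z - b * z\<^sup>2)) / (1 - z\<^sup>2)\<^sup>2) * mehler_fun x y z"
    by (simp add: mehler_fun_def a_def b_def algebra_simps)
  \<comment> \<open>In the second numerator the terms \<open>2 * b * z ^ 3\<close> cancel, leaving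
    \<open>a * (1 + z\<^sup>2) - 2 * b * z\<close>.\<close>
  also have "z / (1 - z\<^sup>2) + ((a - 2 * b * z) * (1 - z\<^sup>2) + 2 * z * (a * z - b * z\<^sup>2)) / (1 - z\<^sup>2)\<^sup>2
    = (z * (1 - z\<^sup>2) + a * (1 + z\<^sup>2) - 2 * b * z) / (1 - z\<^sup>2)\<^sup>2"
  proof -
    have "z / (1 - z\<^sup>2) = z * (1 - z\<^sup>2) / (1 - z\<^sup>2)\<^sup>2"
      using nz by (simp add: power2_eq_square)
    then show ?thesis
      by (simp add: add_divide_distrib[symmetric] algebra_simps power2_eq_square)
  qed
  finally show ?thesis by (simp add: a_def b_def)
qed

lemma mehler_fun_holomorphic: "mehler_fun x y holomorphic_on ball 0 1"
  using mehler_fun_deriv by (subst holomorphic_on_open) blast+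

text \<open>The Taylor series of the closed form and the Hermite series solve the same linear
  equation with the same constant term, so \<open>fps_linear_ode_unique\<close> identifies
  them.\<close>

lemma mehler_fun_expansion: "mehler_fun x y has_fps_expansion mehler_fps x y"
proof -
  define F where "F = fps_expansion (mehler_fun x y) 0"
  have F: "mehler_fun x y has_fps_expansion F"
    unfolding F_def by (intro has_fps_expansion_fps_expansion[OF open_ball _ mehler_fun_holomorphic]) simp
  let ?S = "(1 - fps_X\<^sup>2)\<^sup>2 :: complex fps"
  let ?P = "fps_X * (1 - fps_X\<^sup>2) + fps_const (of_real (2 * x * y)) * (1 + fps_X\<^sup>2)
     - fps_const (of_real (2 * (x\<^sup>2 + y\<^sup>2))) * fps_X :: complex fps"
  have 1: "(\<lambda>z. (1 - z\<^sup>2)\<^sup>2 * deriv (mehler_fun x y) z) has_fps_expansion ?S * fps_deriv F"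
    unfolding power2_eq_square
    by (intro has_fps_expansion_mult has_fps_expansion_add has_fps_expansion_diff
      has_fps_expansion_1 has_fps_expansion_const has_fps_expansion_fps_X has_fps_expansion_deriv F)
  have 2: "(\<lambda>z. (z * (1 - z\<^sup>2) + of_real (2 * x * y) * (1 + z\<^sup>2) - of_real (2 * (x\<^sup>2 + y\<^sup>2)) * z) *
      mehler_fun x y z) has_fps_expansion ?P * F"
    unfolding power2_eq_square
    by (intro has_fps_expansion_mult has_fps_expansion_add has_fps_expansion_diff
      has_fps_expansion_1 has_fps_expansion_const has_fps_expansion_fps_X has_fps_expansion_deriv F)
  have "eventually (\<lambda>z. z \<in> ball 0 1) (nhds (0::complex))"
    by (intro eventually_nhds_in_open) auto
  then have "eventually (\<lambda>z. (1 - z\<^sup>2)\<^sup>2 * deriv (mehler_fun x y) z =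
      (z * (1 - z\<^sup>2) + of_real (2 * x * y) * (1 + z\<^sup>2) - of_real (2 * (x\<^sup>2 + y\<^sup>2)) * z) *
      mehler_fun x y z) (nhds 0)"
  proof eventually_elim
    case (elim z)
    then show ?case
      using one_minus_square_pos(2)[OF elim] by (simp add: DERIV_imp_deriv[OF mehler_fun_deriv])
  qed
  from has_fps_expansion_cong[OF this refl] 2
  have "(\<lambda>z. (1 - z\<^sup>2)\<^sup>2 * deriv (mehler_fun x y) z) has_fps_expansion ?P * F"
    by simp
  with 1 have "?S * fps_deriv F = ?P * F"
    by (rule fps_expansion_unique_complex)
  \<comment> \<open>The constant term of \<open>?S\<close> is 1, so \<open>?S\<close> is a unit and
    the equation can be solved for the derivative.\<close>
  have S: "inverse ?S * ?S = 1"
    by (intro inverse_mult_eq_1) (simp add: fps_mult_nth power2_eq_square)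
  have *: "fps_deriv A = inverse ?S * ?P * A" if "?S * fps_deriv A = ?P * A" for A
  proof -
    have "fps_deriv A = (inverse ?S * ?S) * fps_deriv A"
      unfolding S by simp
    also have "\<dots> = inverse ?S * ?P * A"
      unfolding mult.assoc that ..
    finally show ?thesis .
  qed
  have "fps_deriv F = inverse ?S * ?P * F"
    by (rule *) fact
  moreover have "fps_deriv (mehler_fps x y) = inverse ?S * ?P * mehler_fps x y"
    by (rule *, rule mehler_fps_ode)
  moreover have "fps_nth F 0 = fps_nth (mehler_fps x y) 0"
    by (simp add: F_def fps_expansion_def mehler_fps_def mehler_fun_def mehler_coeff_def Hermite_0)
  ultimately have "F = mehler_fps x y"
    by (rule fps_linear_ode_unique)
  with F show ?thesis by simp
qed

section \<open>Summation of the Hermite series at real arguments\<close>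

lemma mehler_sums:
  assumes "0 \<le> r" "r < 1"
  shows "(\<lambda>n. mehler_coeff x y n * r ^ n) sums
    ((1 - r\<^sup>2) powr (-1 / 2) * exp ((2 * x * y * r - (x\<^sup>2 + y\<^sup>2) * r\<^sup>2) / (1 - r\<^sup>2)))"
proof -
  have E: "mehler_fps x y = fps_expansion (mehler_fun x y) 0"
    using fps_expansion_unique_complex[OF mehler_fun_expansion[of x y]]
      has_fps_expansion_fps_expansion[OF open_ball _ mehler_fun_holomorphic] by simp
  have c: "(deriv ^^ n) (mehler_fun x y) 0 / fact n = of_real (mehler_coeff x y n)" for n
    using arg_cong[OF E, of "\<lambda>F. fps_nth F n"] by (simp add: mehler_fps_def fps_expansion_def)
  have r2: "r\<^sup>2 < 1" using assms by (simp add: power_less_one_iff abs_square_less_1)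
  \<comment> \<open>No growth estimate is required: a function holomorphic on the unit disc is the
    sum of its Taylor series there.\<close>
  have "(\<lambda>n. (deriv ^^ n) (mehler_fun x y) 0 / fact n * (of_real r - 0) ^ n) sums mehler_fun x y (of_real r)"
    using assms by (intro holomorphic_power_series[OF mehler_fun_holomorphic]) auto
  then have "(\<lambda>n. complex_of_real (mehler_coeff x y n * r ^ n)) sums mehler_fun x y (of_real r)"
    by (simp add: c)
  also have "mehler_fun x y (of_real r) = of_real
    ((1 - r\<^sup>2) powr (-1 / 2) * exp ((2 * x * y * r - (x\<^sup>2 + y\<^sup>2) * r\<^sup>2) / (1 - r\<^sup>2)))"
    using r2 powr_of_real[of "1 - r\<^sup>2" "-1 / 2"] by (simp add: mehler_fun_def exp_of_real[symmetric])
  finally show ?thesis by (simp only: sums_of_real_iff)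
qed

lemma mehler_formula:
  assumes "0 \<le> r" "r < 1"
  shows "(\<lambda>n. r ^ n * (hermite_normalized n x * hermite_normalized n y)) sums
    (exp ((2 * x * y * r - (x\<^sup>2 + y\<^sup>2) * r\<^sup>2) / (1 - r\<^sup>2)) / sqrt (pi * (1 - r\<^sup>2)))"
proof -
  have r2: "r\<^sup>2 < 1" using assms by (simp add: power_less_one_iff abs_square_less_1)
  have h: "(a powr (-1/2))\<^sup>2 = 1 / a" if "a > 0" for a :: real
    using that by (simp add: power2_eq_square powr_add[symmetric] powr_neg_one)
  have p: "(pi powr (-1/4))\<^sup>2 = 1 / sqrt pi"
    unfolding power2_eq_square powr_add[symmetric] by (simp add: powr_minus_divide powr_half_sqrt)
  have "r ^ n * (hermite_normalized n x * hermite_normalized n y) =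
      1 / sqrt pi * (mehler_coeff x y n * r ^ n)" for n
  proof -
    have "r ^ n * (hermite_normalized n x * hermite_normalized n y) =
      (pi powr (-1/4))\<^sup>2 * ((2 ^ n * fact n) powr (-1/2))\<^sup>2 * (Hermite n x * Hermite n y) * r ^ n"
      by (simp add: hermite_normalized_def power2_eq_square mult_ac)
    also have "\<dots> = 1 / sqrt pi * (mehler_coeff x y n * r ^ n)"
      unfolding p by (subst h) (simp_all add: mehler_coeff_def)
    finally show ?thesis .
  qed
  then show ?thesis
    using sums_mult[OF mehler_sums[OF assms, of x y], of "1 / sqrt pi"] r2
    by (simp add: powr_minus_divide powr_half_sqrt real_sqrt_mult mult_ac)
qed

section \<open>The kernel\<close>

lemma beta_q_pos: "0 < q \<Longrightarrow> q < 1 \<Longrightarrow> beta_q q > 0"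
  by (simp add: beta_q_def)

lemma beta_q_square: "0 < q \<Longrightarrow> q < 1 \<Longrightarrow> (beta_q q)\<^sup>2 = (1 + q) / (1 - q)"
  by (simp add: beta_q_def)

lemma psi_q_mult:
  assumes "0 < q" "q < 1"
  shows "psi_q q n x * psi_q q n y =
    beta_q q * exp (- (beta_q q)\<^sup>2 * (x\<^sup>2 + y\<^sup>2) / 2) *
      (hermite_normalized n (beta_q q * x) * hermite_normalized n (beta_q q * y))"
proof -
  have "psi_q q n x * psi_q q n y = (sqrt (beta_q q) * sqrt (beta_q q)) *
      (exp (- (beta_q q)\<^sup>2 * x\<^sup>2 / 2) * exp (- (beta_q q)\<^sup>2 * y\<^sup>2 / 2)) *
      (hermite_normalized n (beta_q q * x) * hermite_normalized n (beta_q q * y))"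
    by (simp only: psi_q_def mult_ac)
  also have "sqrt (beta_q q) * sqrt (beta_q q) = beta_q q"
    using beta_q_pos[OF assms] by simp
  also have "exp (- (beta_q q)\<^sup>2 * x\<^sup>2 / 2) * exp (- (beta_q q)\<^sup>2 * y\<^sup>2 / 2) =
      exp (- (beta_q q)\<^sup>2 * (x\<^sup>2 + y\<^sup>2) / 2)"
    by (simp add: exp_add[symmetric] field_simps)
  finally show ?thesis .
qed

text \<open>The scale is tuned to Mehler's formula:
  \<open>(beta_q q)\<^sup>2 / (1 - q\<^sup>2)\<close> equals \<open>1 / (1 - q)\<^sup>2\<close>.
  This puts both exponents over one denominator and turns the prefactor into
  \<open>1 / (sqrt pi * (1 - q))\<close>.\<close>

lemma psi_q_sums:
  assumes "0 < q" "q < 1"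
  shows "(\<lambda>n. q ^ n * (psi_q q n x * psi_q q n y)) sums
    (exp (- (x\<^sup>2 + y\<^sup>2) / 2 - q * (x - y)\<^sup>2 / (1 - q)\<^sup>2) / (sqrt pi * (1 - q)))"
proof -
  define b where "b = beta_q q"
  define E where "E = (2 * (b * x) * (b * y) * q - ((b * x)\<^sup>2 + (b * y)\<^sup>2) * q\<^sup>2) / (1 - q\<^sup>2)"
  have q2: "1 - q\<^sup>2 = (1 - q) * (1 + q)"
    by (simp add: algebra_simps power2_eq_square)
  have "b\<^sup>2 / (1 - q\<^sup>2) = 1 / (1 - q)\<^sup>2"
    unfolding b_def beta_q_square[OF assms] q2 using assms by (simp add: power2_eq_square)
  moreover have "E = (2 * x * y * q - (x\<^sup>2 + y\<^sup>2) * q\<^sup>2) * (b\<^sup>2 / (1 - q\<^sup>2))"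
  proof -
    have "2 * (b * x) * (b * y) * q - ((b * x)\<^sup>2 + (b * y)\<^sup>2) * q\<^sup>2 =
        (2 * x * y * q - (x\<^sup>2 + y\<^sup>2) * q\<^sup>2) * b\<^sup>2"
      by algebra
    then show ?thesis unfolding E_def by simp
  qed
  ultimately have "E = (2 * x * y * q - (x\<^sup>2 + y\<^sup>2) * q\<^sup>2) / (1 - q)\<^sup>2"
    by simp
  moreover have "b\<^sup>2 = (1 + q) * (1 - q) / (1 - q)\<^sup>2"
    unfolding b_def beta_q_square[OF assms] using assms by (simp add: power2_eq_square)
  ultimately have "- b\<^sup>2 * (x\<^sup>2 + y\<^sup>2) / 2 + E =
      (- ((1 + q) * (1 - q) * (x\<^sup>2 + y\<^sup>2)) / 2 + (2 * x * y * q - (x\<^sup>2 + y\<^sup>2) * q\<^sup>2)) / (1 - q)\<^sup>2"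
    by (simp add: add_divide_distrib diff_divide_distrib mult.commute)
  \<comment> \<open>Completing the square separates the part that survives on the diagonal from the
    off-diagonal Gaussian.\<close>
  also have "\<dots> = (- (x\<^sup>2 + y\<^sup>2) / 2 * (1 - q)\<^sup>2 - q * (x - y)\<^sup>2) / (1 - q)\<^sup>2"
    by (simp add: power2_eq_square field_simps)
  also have "\<dots> = - (x\<^sup>2 + y\<^sup>2) / 2 - q * (x - y)\<^sup>2 / (1 - q)\<^sup>2"
    using assms by (simp add: diff_divide_distrib)
  finally have E: "exp (- b\<^sup>2 * (x\<^sup>2 + y\<^sup>2) / 2) * exp E =
      exp (- (x\<^sup>2 + y\<^sup>2) / 2 - q * (x - y)\<^sup>2 / (1 - q)\<^sup>2)"
    by (simp only: exp_add[symmetric])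
  have "b / sqrt (1 - q\<^sup>2) = sqrt ((1 + q) / (1 - q) / ((1 - q) * (1 + q)))"
    by (simp only: b_def beta_q_def q2 real_sqrt_divide)
  also have "(1 + q) / (1 - q) / ((1 - q) * (1 + q)) = (1 / (1 - q))\<^sup>2"
    using assms by (simp add: power2_eq_square)
  also have "sqrt \<dots> = 1 / (1 - q)"
    using assms by (simp del: power_one_over)
  finally have "b / sqrt (1 - q\<^sup>2) / sqrt pi = 1 / (1 - q) / sqrt pi"
    by (rule arg_cong)
  then have b: "b / sqrt (pi * (1 - q\<^sup>2)) = 1 / (sqrt pi * (1 - q))"
    by (simp only: real_sqrt_mult divide_divide_eq_left mult.commute)
  have "(\<lambda>n. b * exp (- b\<^sup>2 * (x\<^sup>2 + y\<^sup>2) / 2) *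
        (q ^ n * (hermite_normalized n (b * x) * hermite_normalized n (b * y)))) sums
      (b * exp (- b\<^sup>2 * (x\<^sup>2 + y\<^sup>2) / 2) * (exp E / sqrt (pi * (1 - q\<^sup>2))))"
    unfolding E_def using assms by (intro sums_mult mehler_formula) auto
  also have "b * exp (- b\<^sup>2 * (x\<^sup>2 + y\<^sup>2) / 2) * (exp E / sqrt (pi * (1 - q\<^sup>2))) =
      (exp (- b\<^sup>2 * (x\<^sup>2 + y\<^sup>2) / 2) * exp E) * (b / sqrt (pi * (1 - q\<^sup>2)))"
    by simp
  finally show ?thesis
    unfolding E b psi_q_mult[OF assms] b_def[symmetric] by (simp add: mult_ac)
qed

lemma psi_q_square_sums:
  assumes "0 < q" "q < 1"
  shows "(\<lambda>n. q ^ n * (psi_q q n x)\<^sup>2) sums (exp (- x\<^sup>2) / (sqrt pi * (1 - q)))"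
  using psi_q_sums[OF assms, of x x] by (simp add: power2_eq_square)

section \<open>Linearization of the kernel, with error bound\<close>

lemma mean_le: "a \<le> c \<Longrightarrow> b \<le> c \<Longrightarrow> (a + b) / 2 \<le> c" for a b c :: real
  by (simp add: divide_le_eq)

lemma abs_mult_le_half_squares: "\<bar>a * b\<bar> \<le> (a\<^sup>2 + b\<^sup>2) / 2" for a b :: real
  using sum_squares_bound[of "\<bar>a\<bar>" "\<bar>b\<bar>"] by (simp add: abs_mult)

lemma power_mult_sqrt: "0 < q \<Longrightarrow> q powr (real n + 1 / 2) = q ^ n * sqrt q"
  by (simp add: powr_add powr_realpow powr_half_sqrt)

text \<open>The linear weights \<open>t n\<close> are summed exactly by \<open>psi_q_sums\<close>.
  The error \<open>t n / (1 + t n) - t n\<close> is at most \<open>(t n)\<^sup>2\<close> in absolute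
  value and is dominated by the diagonal sums \<open>psi_q_square_sums\<close>. Convergence of both
  parts gives that of the kernel.\<close>

lemma hermite_kernel_sums:
  assumes "0 < q" "q < 1" "0 \<le> lam"
  shows hermite_kernel_summable: "summable (\<lambda>n. lam * q powr (real n + 1 / 2) /
      (1 + lam * q powr (real n + 1 / 2)) * psi_q q n x * psi_q q n y)"
    and hermite_kernel_approx: "\<bar>hermite_kernel q lam x y - lam * sqrt q *
      (exp (- (x\<^sup>2 + y\<^sup>2) / 2 - q * (x - y)\<^sup>2 / (1 - q)\<^sup>2) / (sqrt pi * (1 - q)))\<bar>
      \<le> lam\<^sup>2 / (sqrt pi * (1 - q))"
proof -
  define t where "t n = lam * q powr (real n + 1 / 2)" for n
  define p where "p n = psi_q q n x * psi_q q n y" for n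
  define d where "d n = (t n / (1 + t n) - t n) * p n" for n
  define g where "g n = lam\<^sup>2 / 2 * (q ^ n * (psi_q q n x)\<^sup>2 + q ^ n * (psi_q q n y)\<^sup>2)" for n
  define M where "M = exp (- (x\<^sup>2 + y\<^sup>2) / 2 - q * (x - y)\<^sup>2 / (1 - q)\<^sup>2) / (sqrt pi * (1 - q))"
  have t0: "t n \<ge> 0" for n using assms by (simp add: t_def)
  have t: "t n = lam * sqrt q * q ^ n" for n
    using assms by (simp add: t_def power_mult_sqrt)
  have main: "(\<lambda>n. t n * p n) sums (lam * sqrt q * M)"
    using sums_mult[OF psi_q_sums[OF assms(1,2), of x y], of "lam * sqrt q"]
    by (simp add: t p_def M_def mult_ac)
  have g: "g sums (lam\<^sup>2 / 2 * (exp (- x\<^sup>2) / (sqrt pi * (1 - q)) + exp (- y\<^sup>2) / (sqrt pi * (1 - q))))"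
    unfolding g_def using assms by (intro sums_mult sums_add psi_q_square_sums)
  have dg: "norm (d n) \<le> g n" for n
  proof -
    have "t n / (1 + t n) - t n = - (t n)\<^sup>2 / (1 + t n)"
      using t0[of n] by (simp add: field_simps power2_eq_square)
    then have "\<bar>t n / (1 + t n) - t n\<bar> = (t n)\<^sup>2 / (1 + t n)"
      using t0[of n] by simp
    also have "\<dots> \<le> (t n)\<^sup>2 / 1"
      using t0[of n] by (intro divide_left_mono) auto
    \<comment> \<open>One factor \<open>q ^ n\<close> is kept for the diagonal sums; the remaining
      \<open>q ^ n * q\<close> is bounded by 1.\<close>
    also have "\<dots> = lam\<^sup>2 * q ^ n * (q ^ n * q)"
      using assms by (simp add: t power_mult_distrib) (simp add: power2_eq_square)
    also have "\<dots> \<le> lam\<^sup>2 * q ^ n * 1"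
      using assms by (intro mult_left_mono) (auto intro!: mult_le_one power_le_one)
    finally have "\<bar>t n / (1 + t n) - t n\<bar> * \<bar>p n\<bar> \<le>
        lam\<^sup>2 * q ^ n * (((psi_q q n x)\<^sup>2 + (psi_q q n y)\<^sup>2) / 2)"
      unfolding p_def using assms abs_mult_le_half_squares by (intro mult_mono) auto
    moreover have "norm (d n) = \<bar>t n / (1 + t n) - t n\<bar> * \<bar>p n\<bar>"
      unfolding d_def real_norm_def by (rule abs_mult)
    moreover have "g n = lam\<^sup>2 * q ^ n * (((psi_q q n x)\<^sup>2 + (psi_q q n y)\<^sup>2) / 2)"
      by (simp add: g_def distrib_left)
    ultimately show ?thesis by simp
  qed
  have d: "summable d"
    using dg sums_summable[OF g] by (intro summable_comparison_test[of d g]) auto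
  have sum: "(\<lambda>n. t n / (1 + t n) * p n) sums (suminf d + lam * sqrt q * M)"
    using sums_add[OF summable_sums[OF d] main] by (simp add: d_def algebra_simps)
  then show "summable (\<lambda>n. lam * q powr (real n + 1 / 2) /
      (1 + lam * q powr (real n + 1 / 2)) * psi_q q n x * psi_q q n y)"
    by (simp add: sums_iff t_def p_def mult_ac)
  have "hermite_kernel q lam x y = suminf d + lam * sqrt q * M"
    using sum by (simp add: sums_iff hermite_kernel_def t_def p_def mult.assoc)
  then have "\<bar>hermite_kernel q lam x y - lam * sqrt q * M\<bar> = norm (suminf d)"
    by simp
  also have "\<dots> \<le> suminf g"
    using dg sums_summable[OF g] by (rule norm_suminf_le)
  also have "\<dots> = lam\<^sup>2 / (sqrt pi * (1 - q)) * ((exp (- x\<^sup>2) + exp (- y\<^sup>2)) / 2)"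
    using g by (simp add: sums_iff add_divide_distrib[symmetric])
  also have "\<dots> \<le> lam\<^sup>2 / (sqrt pi * (1 - q)) * 1"
  proof (intro mult_left_mono)
    have "exp (- x\<^sup>2) \<le> 1" "exp (- y\<^sup>2) \<le> 1"
      by simp_all
    then show "(exp (- x\<^sup>2) + exp (- y\<^sup>2)) / 2 \<le> 1"
      by (rule mean_le)
  qed (use assms in simp)
  finally show "\<bar>hermite_kernel q lam x y - lam * sqrt q *
      (exp (- (x\<^sup>2 + y\<^sup>2) / 2 - q * (x - y)\<^sup>2 / (1 - q)\<^sup>2) / (sqrt pi * (1 - q)))\<bar>
      \<le> lam\<^sup>2 / (sqrt pi * (1 - q))"
    by (simp add: M_def)
qed

section \<open>The limit as \<mu> tends to 0\<close>

lemma hermite_kernel_limit_0: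
  "((\<lambda>\<mu>. hermite_kernel (exp (- \<mu>)) (exp (\<mu> * real N) - 1) x y) \<longlongrightarrow>
    (if x = y then real N / sqrt pi * exp (- x\<^sup>2) else 0)) (at_right 0)"
proof -
  define lam where "lam \<mu> = exp (\<mu> * real N) - 1" for \<mu>
  define M where "M \<mu> = exp (- (x\<^sup>2 + y\<^sup>2) / 2 - exp (- \<mu>) * (x - y)\<^sup>2 / (1 - exp (- \<mu>))\<^sup>2)
      / (sqrt pi * (1 - exp (- \<mu>)))" for \<mu>
  \<comment> \<open>Numerator and denominator behave like \<open>\<mu> * real N\<close> and \<mu>;
    this quotient is the source of the factor \<open>real N\<close> in the limit.\<close>
  have ratio: "((\<lambda>\<mu>. lam \<mu> / (1 - exp (- \<mu>))) \<longlongrightarrow> real N) (at_right 0)"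
    unfolding lam_def by real_asymp
  have lam0: "(lam \<longlongrightarrow> 0) (at_right 0)"
    unfolding lam_def by real_asymp
  \<comment> \<open>Only one of the two factors \<open>lam \<mu>\<close> is spent on the small
    denominator; the other one drives the error to 0.\<close>
  have "((\<lambda>\<mu>. lam \<mu> * (lam \<mu> / (1 - exp (- \<mu>))) / sqrt pi) \<longlongrightarrow> 0 * real N / sqrt pi) (at_right 0)"
    by (intro tendsto_intros lam0 ratio) simp
  then have err: "((\<lambda>\<mu>. (lam \<mu>)\<^sup>2 / (sqrt pi * (1 - exp (- \<mu>)))) \<longlongrightarrow> 0) (at_right 0)"
    by (simp add: power2_eq_square mult_ac)
  define c where "c = (if x = y then 1 else 0 :: real)"
  \<comment> \<open>Off the diagonal the exponent behaves like
    \<open>- (x - y)\<^sup>2 / \<mu>\<^sup>2\<close> and tends to minus infinity; on the diagonal it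
    is 0.\<close>
  have c: "((\<lambda>\<mu>. exp (- exp (- \<mu>) * (x - y)\<^sup>2 / (1 - exp (- \<mu>))\<^sup>2)) \<longlongrightarrow> c) (at_right 0)"
  proof (cases "x = y")
    case False
    define a where "a = (x - y)\<^sup>2"
    have "a > 0" using False by (simp add: a_def)
    then have "((\<lambda>\<mu>. exp (- exp (- \<mu>) * a / (1 - exp (- \<mu>))\<^sup>2)) \<longlongrightarrow> 0) (at_right 0)"
      by real_asymp
    with False show ?thesis by (simp add: a_def c_def)
  qed (simp add: c_def)
  have q1: "((\<lambda>\<mu>. sqrt (exp (- \<mu>))) \<longlongrightarrow> 1) (at_right (0::real))"
    by real_asymp
  have "((\<lambda>\<mu>. lam \<mu> / (1 - exp (- \<mu>)) * sqrt (exp (- \<mu>)) / sqrt pi * exp (- (x\<^sup>2 + y\<^sup>2) / 2)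
      * exp (- exp (- \<mu>) * (x - y)\<^sup>2 / (1 - exp (- \<mu>))\<^sup>2)) \<longlongrightarrow>
      real N * 1 / sqrt pi * exp (- (x\<^sup>2 + y\<^sup>2) / 2) * c) (at_right 0)"
    by (intro tendsto_intros ratio c q1) simp
  moreover have "lam \<mu> / (1 - exp (- \<mu>)) * sqrt (exp (- \<mu>)) / sqrt pi * exp (- (x\<^sup>2 + y\<^sup>2) / 2)
      * exp (- exp (- \<mu>) * (x - y)\<^sup>2 / (1 - exp (- \<mu>))\<^sup>2) = lam \<mu> * sqrt (exp (- \<mu>)) * M \<mu>" for \<mu>
  proof -
    have "exp (- (x\<^sup>2 + y\<^sup>2) / 2 - exp (- \<mu>) * (x - y)\<^sup>2 / (1 - exp (- \<mu>))\<^sup>2) =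
        exp (- (x\<^sup>2 + y\<^sup>2) / 2) * exp (- exp (- \<mu>) * (x - y)\<^sup>2 / (1 - exp (- \<mu>))\<^sup>2)"
      unfolding exp_add[symmetric] by simp
    then show ?thesis unfolding M_def by (simp add: mult_ac)
  qed
  moreover have "real N * 1 / sqrt pi * exp (- (x\<^sup>2 + y\<^sup>2) / 2) * c =
      (if x = y then real N / sqrt pi * exp (- x\<^sup>2) else 0)"
    by (simp add: c_def)
  ultimately have main: "((\<lambda>\<mu>. lam \<mu> * sqrt (exp (- \<mu>)) * M \<mu>) \<longlongrightarrow>
      (if x = y then real N / sqrt pi * exp (- x\<^sup>2) else 0)) (at_right 0)"
    by simp
  have "((\<lambda>\<mu>. hermite_kernel (exp (- \<mu>)) (lam \<mu>) x y - lam \<mu> * sqrt (exp (- \<mu>)) * M \<mu>) \<longlongrightarrow> 0) (at_right 0)"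
  proof (rule Lim_null_comparison[OF _ err])
    show "\<forall>\<^sub>F \<mu> in at_right 0. norm (hermite_kernel (exp (- \<mu>)) (lam \<mu>) x y - lam \<mu> * sqrt (exp (- \<mu>)) * M \<mu>)
        \<le> (lam \<mu>)\<^sup>2 / (sqrt pi * (1 - exp (- \<mu>)))"
      using eventually_at_right_less[of "0::real"]
    proof eventually_elim
      case (elim \<mu>)
      then show ?case
        using hermite_kernel_approx[of "exp (- \<mu>)" "lam \<mu>" x y] by (simp add: M_def lam_def)
    qed
  qed
  from tendsto_add[OF this main] show ?thesis
    by (simp add: lam_def)
qed


section \<open>The limit as \<mu> tends to infinity\<close>

lemma uniform_limit_parameter:
  fixes f :: "'a::topological_space \<Rightarrow> 'b::topological_space \<Rightarrow> 'c::metric_space"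
  assumes "continuous_on (UNIV \<times> S) (\<lambda>(a, x). f a x)" "compact S" "(g \<longlongrightarrow> a) F"
  shows "uniform_limit S (\<lambda>t. f (g t)) (f a) F"
proof (rule uniform_limitI)
  fix e :: real assume "e > 0"
  \<comment> \<open>Compactness yields a neighbourhood of \<open>a\<close> with a non-strict bound
    valid for all of \<open>S\<close>, so half of \<open>e\<close> is used.\<close>
  then have "e / 2 > 0" by simp
  then obtain X where X: "a \<in> X" "open X" "\<forall>b\<in>X \<inter> UNIV. \<forall>x\<in>S. dist (f b x) (f a x) \<le> e / 2"
    using continuous_on_prod_compactE[OF assms(1,2) UNIV_I] by (metis (mono_tags, lifting) case_prod_conv)
  have "\<forall>\<^sub>F t in F. g t \<in> X"
    using assms(3) X(1,2) by (simp add: topological_tendstoD)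
  then show "\<forall>\<^sub>F t in F. \<forall>x\<in>S. dist (f (g t) x) (f a x) < e"
  proof eventually_elim
    case (elim t)
    then show ?case using X(3) \<open>e > 0\<close> by fastforce
  qed
qed

lemma continuous_on_hermite_normalized [continuous_intros]:
  "continuous_on A f \<Longrightarrow> continuous_on A (\<lambda>x. hermite_normalized n (f x))"
  unfolding hermite_normalized_def Hermite_eq_poly by (intro continuous_intros)

lemma beta_q_tendsto: "((\<lambda>\<mu>. beta_q (exp (- \<mu>))) \<longlongrightarrow> 1) at_top"
  unfolding beta_q_def by real_asymp

text \<open>As \<open>n < N\<close> are integers, \<open>c = real N - real n - 1 / 2\<close> is
  positive, so \<open>t\<close> grows like \<open>exp (c * \<mu>)\<close> and its weight saturates
  at 1.\<close>

lemma weight_tendsto: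
  assumes "n < N"
  defines "t \<equiv> \<lambda>\<mu>. (exp (\<mu> * real N) - 1) * exp (- \<mu>) powr (real n + 1 / 2)"
  shows "((\<lambda>\<mu>. t \<mu> / (1 + t \<mu>)) \<longlongrightarrow> 1) at_top"
proof -
  define c where "c = real N - real n - 1 / 2"
  define d where "d = real n + 1 / 2"
  have "real n + 1 \<le> real N" using assms(1) by linarith
  then have cd: "c > 0" "d > 0" by (simp_all add: c_def d_def)
  have t: "t \<mu> = exp (c * \<mu>) - exp (- d * \<mu>)" for \<mu>
    by (simp add: t_def c_def d_def powr_def left_diff_distrib exp_add[symmetric] algebra_simps)
  have "filterlim t at_top at_top"
  proof (rule filterlim_at_top_mono)
    show "filterlim (\<lambda>\<mu>. exp (c * \<mu>) - 1) at_top at_top"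
      using cd by real_asymp
    show "\<forall>\<^sub>F \<mu> in at_top. exp (c * \<mu>) - 1 \<le> t \<mu>"
      using eventually_ge_at_top[of 0] by eventually_elim (use cd in \<open>simp add: t\<close>)
  qed
  moreover have "((\<lambda>s::real. s / (1 + s)) \<longlongrightarrow> 1) at_top"
    by real_asymp
  ultimately show ?thesis
    using filterlim_compose by blast
qed

text \<open>The term depends on \<mu> only through its weight and \<open>beta_q\<close>. Both tend
  to 1, and joint continuity makes the convergence uniform on \<open>S\<close>.\<close>

lemma kernel_term_uniform_limit:
  fixes S :: "(real \<times> real) set"
  assumes "compact S" "n < N"
  defines "t \<equiv> \<lambda>\<mu>. (exp (\<mu> * real N) - 1) * exp (- \<mu>) powr (real n + 1 / 2)"
  shows "uniform_limit S (\<lambda>\<mu> (x, y). t \<mu> / (1 + t \<mu>) * psi_q (exp (- \<mu>)) n x * psi_q (exp (- \<mu>)) n y)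
    (\<lambda>(x, y). hermite_normalized n x * hermite_normalized n y * exp (- (x\<^sup>2 + y\<^sup>2) / 2)) at_top"
proof -
  \<comment> \<open>This is \<open>psi_q\<close> with the scale as a free parameter
    \<open>b\<close>; it is continuous for all real \<open>b\<close>, since \<open>sqrt\<close>
    is.\<close>
  define p where "p b x = sqrt b * hermite_normalized n (b * x) * exp (- b\<^sup>2 * x\<^sup>2 / 2)" for b x
  define f where "f = (\<lambda>(w, b) (x, y). w * p b x * p b y)"
  have "continuous_on (UNIV \<times> S) (\<lambda>(a, x). f a x)"
    unfolding f_def p_def case_prod_unfold by (intro continuous_intros) auto
  moreover have "((\<lambda>\<mu>. (t \<mu> / (1 + t \<mu>), beta_q (exp (- \<mu>)))) \<longlongrightarrow> (1, 1)) at_top"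
    unfolding t_def by (intro tendsto_Pair weight_tendsto beta_q_tendsto assms)
  ultimately have "uniform_limit S (\<lambda>\<mu>. f (t \<mu> / (1 + t \<mu>), beta_q (exp (- \<mu>)))) (f (1, 1)) at_top"
    using assms(1) by (intro uniform_limit_parameter)
  moreover have "f (t \<mu> / (1 + t \<mu>), beta_q (exp (- \<mu>))) =
      (\<lambda>(x, y). t \<mu> / (1 + t \<mu>) * psi_q (exp (- \<mu>)) n x * psi_q (exp (- \<mu>)) n y)" for \<mu>
    by (simp add: f_def p_def psi_q_def)
  moreover have "f (1, 1) =
      (\<lambda>(x, y). hermite_normalized n x * hermite_normalized n y * exp (- (x\<^sup>2 + y\<^sup>2) / 2))"
  proof -
    have "exp (- (x\<^sup>2 + y\<^sup>2) / 2) = exp (- x\<^sup>2 / 2) * exp (- y\<^sup>2 / 2)" for x y :: real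
      by (simp add: exp_add[symmetric] field_simps)
    then show ?thesis by (auto simp: f_def p_def fun_eq_iff)
  qed
  ultimately show ?thesis by simp
qed

text \<open>On the diagonal all terms of Mehler's series are nonnegative, so each is at most the
  sum. At \<open>r = 1 / 2\<close> the exponent is \<open>2 * x\<^sup>2 / 3\<close> and the root is
  at least 1, so the sum is at most \<open>exp (x\<^sup>2)\<close>.\<close>

lemma hermite_normalized_square_le: "(hermite_normalized n x)\<^sup>2 * exp (- x\<^sup>2) \<le> 2 ^ n"
proof -
  define E where "E = exp ((2 * x * x * (1 / 2) - (x\<^sup>2 + x\<^sup>2) * (1 / 2)\<^sup>2) / (1 - (1 / 2)\<^sup>2)) / sqrt (pi * (1 - (1 / 2)\<^sup>2))"
  have s: "(\<lambda>n. (1 / 2) ^ n * (hermite_normalized n x * hermite_normalized n x)) sums E"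
    unfolding E_def by (rule mehler_formula) auto
  have "(1 / 2) ^ n * (hermite_normalized n x * hermite_normalized n x) \<le> E"
    using sum_le_suminf[OF sums_summable[OF s], of "{n}"] sums_unique[OF s] by simp
  also have "E \<le> exp (x\<^sup>2) / 1"
    unfolding E_def
  proof (rule frac_le)
    have "pi * (1 - (1 / 2)\<^sup>2) \<ge> 1"
      using pi_gt3 by (simp add: power2_eq_square)
    then show "1 \<le> sqrt (pi * (1 - (1 / 2)\<^sup>2))" by simp
    show "exp ((2 * x * x * (1 / 2) - (x\<^sup>2 + x\<^sup>2) * (1 / 2)\<^sup>2) / (1 - (1 / 2)\<^sup>2)) \<le> exp (x\<^sup>2)"
      by (simp add: power2_eq_square)
  qed auto
  finally have "(1 / 2) ^ n * (hermite_normalized n x)\<^sup>2 * exp (- x\<^sup>2) \<le> exp (x\<^sup>2) * exp (- x\<^sup>2)"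
    by (intro mult_right_mono) (auto simp: power2_eq_square)
  then show ?thesis
    by (simp add: exp_add[symmetric] power_divide field_simps)
qed

lemma psi_q_mult_le:
  assumes "0 < q" "q < 1"
  shows "\<bar>psi_q q n x * psi_q q n y\<bar> \<le> beta_q q * 2 ^ n"
proof -
  have sq: "(psi_q q n x)\<^sup>2 \<le> beta_q q * 2 ^ n" for x
  proof -
    have "(psi_q q n x)\<^sup>2 = beta_q q * ((hermite_normalized n (beta_q q * x))\<^sup>2 * exp (- (beta_q q * x)\<^sup>2))"
      using psi_q_mult[OF assms, of n x x] by (simp add: power2_eq_square mult_ac)
    also have "\<dots> \<le> beta_q q * 2 ^ n"
      using beta_q_pos[OF assms] hermite_normalized_square_le by (intro mult_left_mono) auto
    finally show ?thesis .
  qed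
  show ?thesis
    using abs_mult_le_half_squares mean_le[OF sq sq] by (rule order.trans)
qed

text \<open>At index \<open>m + N\<close> the weight is at most \<open>sqrt q * q ^ m\<close>,
  because \<open>lam * q ^ N\<close> is at most 1. The bound \<open>2 ^ (m + N)\<close> on the
  Hermite factors is absorbed since \<open>2 * q\<close> is at most \<open>1 / 2\<close>; a
  geometric series remains.\<close>

lemma hermite_kernel_tail:
  assumes "0 < q" "q \<le> 1 / 4" "0 \<le> lam" "lam * q ^ N \<le> 1"
  shows "\<bar>hermite_kernel q lam x y - (\<Sum>n<N. lam * q powr (real n + 1 / 2) /
      (1 + lam * q powr (real n + 1 / 2)) * psi_q q n x * psi_q q n y)\<bar> \<le> 4 * 2 ^ N * sqrt q"
proof -
  define t where "t n = lam * q powr (real n + 1 / 2)" for n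
  define k where "k n = t n / (1 + t n) * psi_q q n x * psi_q q n y" for n
  have q: "q < 1" using assms by simp
  have t0: "t n \<ge> 0" for n using assms by (simp add: t_def)
  have "(1 + q) / (1 - q) \<le> 2\<^sup>2"
    using assms by (simp add: divide_le_eq)
  then have b: "beta_q q \<le> 2"
    unfolding beta_q_def by (intro real_le_lsqrt) auto
  have k: "norm (k (m + N)) \<le> 2 * 2 ^ N * sqrt q * (1 / 2) ^ m" for m
  proof -
    have "\<bar>t (m + N) / (1 + t (m + N))\<bar> \<le> t (m + N) / 1"
      using t0[of "m + N"] by (simp add: divide_le_eq mult_left_mono distrib_left)
    also have "\<dots> = (lam * q ^ N) * (sqrt q * q ^ m)"
      unfolding t_def power_mult_sqrt[OF assms(1)] power_add by simp
    also have "\<dots> \<le> 1 * (sqrt q * q ^ m)"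
      using assms by (intro mult_right_mono) auto
    finally have "\<bar>t (m + N) / (1 + t (m + N))\<bar> * \<bar>psi_q q (m + N) x * psi_q q (m + N) y\<bar> \<le>
        (sqrt q * q ^ m) * (beta_q q * 2 ^ (m + N))"
      using psi_q_mult_le[OF assms(1) q] assms(1) by (intro mult_mono) auto
    also have "\<dots> \<le> (sqrt q * q ^ m) * (2 * 2 ^ (m + N))"
      using b assms by (intro mult_left_mono mult_right_mono) auto
    also have "\<dots> = 2 * 2 ^ N * sqrt q * (2 * q) ^ m"
      by (simp add: power_add power_mult_distrib)
    also have "\<dots> \<le> 2 * 2 ^ N * sqrt q * (1 / 2) ^ m"
      using assms by (intro mult_left_mono power_mono) auto
    finally show ?thesis by (simp only: k_def real_norm_def abs_mult mult.assoc)
  qed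
  have geo: "(\<lambda>m. 2 * 2 ^ N * sqrt q * (1 / 2) ^ m) sums (2 * 2 ^ N * sqrt q * 2)"
    using sums_mult[OF geometric_sums[of "1 / 2 :: real"], of "2 * 2 ^ N * sqrt q"] by simp
  have "summable k"
    unfolding k_def t_def using assms(1,3) q by (intro hermite_kernel_summable)
  then have "hermite_kernel q lam x y - (\<Sum>n<N. k n) = (\<Sum>m. k (m + N))"
    using suminf_split_initial_segment[of k N] unfolding hermite_kernel_def k_def[symmetric] t_def[symmetric]
    by simp
  then have "\<bar>hermite_kernel q lam x y - (\<Sum>n<N. k n)\<bar> = norm (\<Sum>m. k (m + N))"
    by simp
  also have "\<dots> \<le> (\<Sum>m. 2 * 2 ^ N * sqrt q * (1 / 2) ^ m)"
    using k sums_summable[OF geo] by (rule norm_suminf_le)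
  also have "\<dots> = 4 * 2 ^ N * sqrt q"
    using sums_unique[OF geo] by simp
  finally show ?thesis
    by (simp add: k_def t_def)
qed

lemma uniform_limit_finite_sum:
  fixes f :: "'i \<Rightarrow> 'a \<Rightarrow> 'b \<Rightarrow> 'c::real_normed_vector"
  assumes "\<And>i. i \<in> I \<Longrightarrow> uniform_limit S (f i) (l i) F"
  shows "uniform_limit S (\<lambda>t x. \<Sum>i\<in>I. f i t x) (\<lambda>x. \<Sum>i\<in>I. l i x) F"
  using assms by (induction I rule: infinite_finite_induct) (auto intro!: uniform_limit_intros)

text \<open>The first \<open>N\<close> terms converge uniformly on \<open>S\<close> one by one; the
  tail is bounded by a null function of \<mu> that does not depend on the point.\<close>

lemma hermite_kernel_limit_infinity:
  fixes S :: "(real \<times> real) set"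
  assumes "compact S"
  shows "uniform_limit S (\<lambda>\<mu> (x, y). hermite_kernel (exp (- \<mu>)) (exp (\<mu> * real N) - 1) x y)
    (\<lambda>(x, y). \<Sum>n<N. hermite_normalized n x * hermite_normalized n y * exp (- (x\<^sup>2 + y\<^sup>2) / 2)) at_top"
proof -
  define k where "k n \<mu> = (\<lambda>(x, y). let t = (exp (\<mu> * real N) - 1) * exp (- \<mu>) powr (real n + 1 / 2) in
    t / (1 + t) * psi_q (exp (- \<mu>)) n x * psi_q (exp (- \<mu>)) n y)" for n \<mu>
  define l where "l n = (\<lambda>(x, y). hermite_normalized n x * hermite_normalized n y * exp (- (x\<^sup>2 + y\<^sup>2) / 2))" for n
  define K where "K \<mu> = (\<lambda>(x, y). hermite_kernel (exp (- \<mu>)) (exp (\<mu> * real N) - 1) x y)" for \<mu>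
  have main: "uniform_limit S (\<lambda>\<mu> z. \<Sum>n<N. k n \<mu> z) (\<lambda>z. \<Sum>n<N. l n z) at_top"
    unfolding k_def l_def Let_def using assms
    by (intro uniform_limit_finite_sum kernel_term_uniform_limit) auto
  have "uniform_limit S (\<lambda>\<mu> z. K \<mu> z - (\<Sum>n<N. k n \<mu> z)) (\<lambda>z. 0) at_top"
  proof (rule uniform_limit_null_comparison)
    have "((\<lambda>\<mu>. 4 * 2 ^ N * sqrt (exp (- \<mu>))) \<longlongrightarrow> 0) (at_top :: real filter)"
      by real_asymp
    then show "uniform_limit S (\<lambda>\<mu> z. 4 * 2 ^ N * sqrt (exp (- \<mu>))) (\<lambda>z. 0) (at_top :: real filter)"
      by (auto simp: uniform_limit_iff tendsto_iff elim!: eventually_mono)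
    have "eventually (\<lambda>\<mu>::real. exp (- \<mu>) \<le> 1 / 4) at_top"
      by real_asymp
    then show "\<forall>\<^sub>F \<mu> in at_top. \<forall>z\<in>S. norm (K \<mu> z - (\<Sum>n<N. k n \<mu> z)) \<le> 4 * 2 ^ N * sqrt (exp (- \<mu>))"
      using eventually_ge_at_top[of 0]
    proof eventually_elim
      case (elim \<mu>)
      \<comment> \<open>Verifies \<open>lam * q ^ N \<le> 1\<close> by dropping the
        \<open>- 1\<close>.\<close>
      have "(exp (\<mu> * real N) - 1) * exp (- \<mu>) ^ N \<le> exp (\<mu> * real N) * exp (- \<mu>) ^ N"
        by (intro mult_right_mono) auto
      also have "\<dots> = 1"
        by (simp add: exp_of_nat_mult[symmetric] exp_add[symmetric] mult.commute)
      finally show ?case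
        using hermite_kernel_tail[of "exp (- \<mu>)" "exp (\<mu> * real N) - 1" N] elim
        by (auto simp: K_def k_def Let_def)
    qed
  qed
  from uniform_limit_add[OF this main] show ?thesis
    by (simp add: K_def l_def case_prod_unfold)
qed

theorem proposition1p8:
  fixes N :: nat and K :: "real \<Rightarrow> real \<Rightarrow> real \<Rightarrow> real"
  defines "K \<equiv> \<lambda>\<mu>. hermite_kernel (exp (- \<mu>)) (exp (\<mu> * real N) - 1)"
  shows "(\<forall>S :: (real \<times> real) set. compact S \<longrightarrow>
            uniform_limit S (\<lambda>\<mu> (x, y). K \<mu> x y)
              (\<lambda>(x, y). \<Sum>n<N. hermite_normalized n x * hermite_normalized n y * exp (- (x\<^sup>2 + y\<^sup>2) / 2))
              at_top) \<and>
         (\<forall>x y. ((\<lambda>\<mu>. K \<mu> x y) \<longlongrightarrow> (if x = y then real N / sqrt pi * exp (- x\<^sup>2) else 0)) (at_right 0))"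
  unfolding K_def using hermite_kernel_limit_infinity hermite_kernel_limit_0 by blast

end
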